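(* Let $n,k\ge 1$ and let ${\bf C}=(C_0,C_1,\dots,C_k)$ be a $(k+1)$-tuple of real $n\times n$ matrices having the $\mathbf{SSM}$-$W$ property. Then $\mathrm{SOL}({\bf C},{\bf d},q)\neq\emptyset$ for all $q\in\mathbb{R}^n$ and all ${\bf d}\in(\mathbb{R}^n_{++})^{k-1}$.
   Context: Notation: $\mathbb{R}^n_{++}$ is the set of vectors in $\mathbb{R}^n$ with all entries positive; $x\wedge y$ is the componentwise minimum and $x*y$ the Hadamard (componentwise) product of $x,y\in\mathbb{R}^n$; inequalities between vectors are componentwise. Extended horizontal linear complementarity problem: given ${\bf C}=(C_0,\dots,C_k)$ with $C_i\in\mathbb{R}^{n\times n}$, $q\in\mathbb{R}^n$ and ${\bf d}=(d_1,\dots,d_{k-1})\in(\mathbb{R}^n_{++})^{k-1}$ (empty if $k=1$), $\mathrm{EHLCP}({\bf C},{\bf d},q)$ asks for $(x_0,x_1,\dots,x_k)\in(\mathbb{R}^n)^{k+1}$ with $$C_0x_0=q+\sum_{i=1}^k C_ix_i,\qquad x_0\wedge x_1=0,\qquad (d_j-x_j)\wedge x_{j+1}=0\ \ (1\le j\le k-1).$$ $\mathrm{SOL}({\bf C},{\bf d},q)$ denotes the set of all its solutions. ${\bf C}$ has the $\mathbf{SSM}$-$W$ property if, for all $x_0,x_1,\dots,x_k\in\mathbb{R}^n$, the conditions $C_0x_0=\sum_{i=1}^kC_ix_i$, $x_i\ge 0$ and $x_0*x_i\le 0$ for all $i\in\{1,\dots,k\}$ imply $x_0=x_1=\dots=x_k=0$.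 (No sign condition is imposed on $x_0$.) *)

theory Defs
  imports "HOL-Analysis.Analysis"
begin

text \<open>A tuple of vectors or matrices is a function on \<^typ>\<open>nat\<close>, read only on the relevant
  index range: \<open>{0..k}\<close> for \<open>C\<close> and \<open>x\<close>, \<open>{1..<k}\<close> for \<open>d\<close>.
  On \<^typ>\<open>real ^ 'n\<close>, \<^const>\<open>inf\<close>, \<open>*\<close> and \<open>\<le>\<close> are componentwise.\<close>

text \<open>The order \<open><\<close> on \<^typ>\<open>real ^ 'n\<close> is not componentwise, so the open positive orthant
  is spelled out.\<close>

definition pos_orthant :: "(real ^ 'n) set" where
  "pos_orthant = {v. \<forall>i. 0 < v $ i}"

definition SSM_W :: "nat \<Rightarrow> (nat \<Rightarrow> real ^ 'n ^ 'n) \<Rightarrow> bool" where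
  "SSM_W k C \<longleftrightarrow>
     (\<forall>x :: nat \<Rightarrow> real ^ 'n.
        C 0 *v x 0 = (\<Sum>i = 1..k. C i *v x i) \<longrightarrow>
        (\<forall>i \<in> {1..k}. 0 \<le> x i \<and> x 0 * x i \<le> 0) \<longrightarrow>
        (\<forall>i \<in> {0..k}. x i = 0))"

text \<open>Extensionality on \<open>{0..k}\<close> makes the elements of \<open>SOL\<close> correspond
  one-to-one to the solution tuples \<open>(x 0, \<dots>, x k)\<close>.\<close>

definition SOL ::
  "nat \<Rightarrow> (nat \<Rightarrow> real ^ 'n ^ 'n) \<Rightarrow> (nat \<Rightarrow> real ^ 'n) \<Rightarrow> real ^ 'n \<Rightarrow> (nat \<Rightarrow> real ^ 'n) set" where
  "SOL k C d q =
     {x \<in> {0..k} \<rightarrow>\<^sub>E UNIV.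
        C 0 *v x 0 = q + (\<Sum>i = 1..k. C i *v x i) \<and>
        inf (x 0) (x 1) = 0 \<and>
        (\<forall>j \<in> {1..<k}. inf (d j - x j) (x (j + 1)) = 0)}"

end

theory Submission
  imports Defs
begin

text \<open>The complementarity conditions on \<open>x 1, \<dots>, x k\<close> are solved by a single vector
  \<open>y = x 1 + \<dots> + x k \<ge> 0\<close>, so the problem becomes the nonlinear complementarity problem
  \<open>inf (f y) y = 0\<close> for a continuous \<open>f\<close>. Since \<open>x 1, \<dots>, x (k - 1)\<close> stay bounded, \<open>f\<close> differs
  from the linear map \<open>M = (C 0)\<^sup>-\<^sup>1 (C k)\<close> by a bounded amount, and \<open>SSM_W\<close> makes \<open>M\<close> strictly
  semimonotone. Brouwer's theorem solves the truncated problem on \<open>[0, r]\<^sup>n\<close>; there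
  \<open>y * f y \<le> 0\<close>, whereas strict semimonotonicity makes some component of \<open>y * (M *v y)\<close>
  at least \<open>e * (norm y)\<^sup>2\<close>. Hence \<open>y\<close> misses the artificial bound \<open>r\<close> when \<open>r\<close> is large.\<close>

text \<open>Brouwer is applied to the projection of \<open>y - f y\<close> onto the box. At a fixed
  point, a component with \<open>f y $ i\<close> nonzero is clamped: to \<open>r\<close> if it is
  negative, to 0 if it is positive.\<close>

lemma box_complementarity:
  fixes f :: "real ^ 'n \<Rightarrow> real ^ 'n"
  assumes "0 \<le> r" and cont: "continuous_on {y. 0 \<le> y} f"
  obtains y where "0 \<le> y" "\<And>i. y $ i < r \<Longrightarrow> 0 \<le> f y $ i" "\<And>i. 0 < y $ i \<Longrightarrow> f y $ i \<le> 0"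
proof -
  let ?S = "cbox 0 (\<chi> i. r) :: (real ^ 'n) set"
  define g where "g = (\<lambda>y. \<chi> i. max 0 (min r (y $ i - f y $ i)))"
  have "?S \<subseteq> {y. 0 \<le> y}"
    by (auto simp: mem_box_cart less_eq_vec_def)
  then have "continuous_on ?S f"
    using cont continuous_on_subset by blast
  then have "continuous_on ?S g"
    unfolding g_def by (intro continuous_intros)
  moreover have "g \<in> ?S \<rightarrow> ?S"
    using \<open>0 \<le> r\<close> by (auto simp: g_def mem_box_cart)
  moreover have "?S \<noteq> {}"
    using \<open>0 \<le> r\<close> by (auto simp: interval_ne_empty_cart)
  ultimately obtain y where y: "y \<in> ?S" "g y = y"
    using brouwer[of ?S g] by (auto simp: compact_cbox)
  have *: "y $ i = max 0 (min r (y $ i - f y $ i))" for i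
    using arg_cong[OF y(2), of "\<lambda>v. v $ i"] by (simp add: g_def)
  show ?thesis
  proof
    show "0 \<le> y"
      using y(1) by (auto simp: mem_box_cart less_eq_vec_def)
    show "0 \<le> f y $ i" if "y $ i < r" for i
      using *[of i] that by (auto simp: max_def min_def split: if_splits)
    show "f y $ i \<le> 0" if "0 < y $ i" for i
      using *[of i] that by (auto simp: max_def min_def split: if_splits)
  qed
qed

text \<open>Compactness gives the bound on nonnegative unit vectors; both sides are homogeneous of
  degree two, so scaling extends it.\<close>

lemma strictly_semimonotone_growth:
  fixes M :: "real ^ 'n ^ 'n"
  assumes M: "\<And>u. 0 \<le> u \<Longrightarrow> u * (M *v u) \<le> 0 \<Longrightarrow> u = 0"
  obtains e where "0 < e" "\<And>y. 0 \<le> y \<Longrightarrow> \<exists>i. e * (norm y)\<^sup>2 \<le> y $ i * (M *v y) $ i"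
proof -
  \<comment> \<open>Summing positive parts keeps continuity, and the sum is positive as soon as one
    product is.\<close>
  define h where "h = (\<lambda>u. \<Sum>i\<in>UNIV. max 0 (u $ i * (M *v u) $ i))"
  let ?K = "{u :: real ^ 'n. 0 \<le> u} \<inter> sphere 0 1"
  have "{u :: real ^ 'n. 0 \<le> u} = (\<Inter>i. {u. 0 \<le> u $ i})"
    by (auto simp: less_eq_vec_def)
  also have "closed \<dots>"
    by (intro closed_INT ballI closed_Collect_le continuous_intros)
  finally have "compact ?K"
    by (intro closed_Int_compact compact_sphere)
  moreover have "?K \<noteq> {}"
  proof -
    have "axis undefined 1 \<in> ?K"
      by (auto simp: less_eq_vec_def norm_axis_1) (simp add: axis_def)
    then show ?thesis by blast
  qed
  moreover have "continuous_on ?K h"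
    unfolding h_def by (intro continuous_intros matrix_vector_mult_linear_continuous_on)
  ultimately obtain u where u: "u \<in> ?K" "\<And>v. v \<in> ?K \<Longrightarrow> h u \<le> h v"
    using continuous_attains_inf[of ?K h] by blast
  have "0 < h u"
  proof -
    have "u \<noteq> 0" using u(1) by auto
    then have "\<not> u * (M *v u) \<le> 0" using M u(1) by auto
    then obtain i where "0 < u $ i * (M *v u) $ i"
      by (auto simp: less_eq_vec_def not_le)
    then show ?thesis
      unfolding h_def by (intro sum_pos2[of _ i]) auto
  qed
  \<comment> \<open>Averaging: at least one of the \<open>CARD('n)\<close> summands of
    \<open>h v\<close> reaches \<open>e\<close>.\<close>
  define e where "e = h u / CARD('n)"
  show ?thesis
  proof
    show "0 < e" using \<open>0 < h u\<close> by (simp add: e_def)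
    show "\<exists>i. e * (norm y)\<^sup>2 \<le> y $ i * (M *v y) $ i" if "0 \<le> y" for y
    proof (cases "y = 0")
      case False
      define v where "v = inverse (norm y) *\<^sub>R y"
      have "v \<in> ?K"
        using that False by (auto simp: v_def less_eq_vec_def)
      then have "h u \<le> h v" by (rule u(2))
      have "\<exists>i. e \<le> max 0 (v $ i * (M *v v) $ i)"
      proof (rule ccontr)
        assume "\<not> ?thesis"
        then have "h v < (\<Sum>i\<in>(UNIV :: 'n set). e)"
          unfolding h_def by (intro sum_strict_mono) (auto simp: not_le)
        then show False using \<open>h u \<le> h v\<close> by (simp add: e_def)
      qed
      then obtain i where "e \<le> v $ i * (M *v v) $ i"
        using \<open>0 < e\<close> by (auto simp: max_def split: if_splits)
      moreover have "v $ i * (M *v v) $ i * (norm y)\<^sup>2 = y $ i * (M *v y) $ i"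
        using False by (simp add: v_def matrix_vector_mult_scaleR power2_eq_square field_simps)
      ultimately show ?thesis
        by (metis mult_right_mono zero_le_power2)
    qed auto
  qed
qed

lemma nonlinear_complementarity:
  fixes M :: "real ^ 'n ^ 'n"
  assumes M: "\<And>u. 0 \<le> u \<Longrightarrow> u * (M *v u) \<le> 0 \<Longrightarrow> u = 0"
    and cont: "continuous_on {y. 0 \<le> y} f"
    and bound: "\<And>y. 0 \<le> y \<Longrightarrow> norm (f y - M *v y) \<le> B"
  obtains y where "0 \<le> y" "inf (f y) y = 0"
proof -
  obtain e where e: "0 < e" "\<And>y. 0 \<le> y \<Longrightarrow> \<exists>i. e * (norm y)\<^sup>2 \<le> y $ i * (M *v y) $ i"
    using strictly_semimonotone_growth[of M] M by blast
  have "0 \<le> B" using bound[of 0] norm_ge_zero order_trans by blast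
  \<comment> \<open>The summand 1 turns the later bound \<open>norm y \<le> B / e\<close> into the
    strict \<open>y $ j < r\<close>.\<close>
  define r where "r = B / e + 1"
  have "0 \<le> r" using \<open>0 \<le> B\<close> e(1) by (simp add: r_def)
  obtain y where y: "0 \<le> y" "\<And>i. y $ i < r \<Longrightarrow> 0 \<le> f y $ i" "\<And>i. 0 < y $ i \<Longrightarrow> f y $ i \<le> 0"
    using box_complementarity[OF \<open>0 \<le> r\<close> cont] by blast
  have nonneg: "0 \<le> y $ i" for i using y(1) by (simp add: less_eq_vec_def)
  obtain i where i: "e * (norm y)\<^sup>2 \<le> y $ i * (M *v y) $ i"
    using e(2) y(1) by blast
  have "y $ i * f y $ i \<le> 0"
    using nonneg[of i] y(3)[of i] by (cases "y $ i = 0") (auto intro: mult_nonneg_nonpos)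
  then have "e * (norm y)\<^sup>2 \<le> y $ i * (M *v y - f y) $ i"
    using i by (simp add: algebra_simps)
  also have "\<dots> \<le> y $ i * B"
    using component_le_norm_cart[of "M *v y - f y" i] bound[OF y(1)] nonneg[of i]
    by (intro mult_left_mono) (auto simp: norm_minus_commute)
  also have "\<dots> \<le> norm y * B"
    using component_le_norm_cart[of y i] \<open>0 \<le> B\<close> by (intro mult_right_mono) auto
  finally have "norm y * (e * norm y) \<le> norm y * B"
    by (simp add: power2_eq_square algebra_simps)
  then have "norm y \<le> B / e"
    using \<open>0 \<le> B\<close> e(1) by (cases "y = 0") (auto simp: field_simps)
  then have less: "y $ j < r" for j
    using component_le_norm_cart[of y j] by (simp add: r_def)
  have "min (f y $ j) (y $ j) = 0" for j
    using y(2)[OF less, of j] y(3)[of j] nonneg[of j] by (cases "y $ j = 0") (auto simp: min_def)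
  then have "inf (f y) y = 0"
    by (simp add: vec_eq_iff inf_vec_def inf_real_def)
  then show thesis using that y(1) by blast
qed

text \<open>For nonnegative \<open>y\<close> and \<open>d\<close> this is the positive part of
  \<open>y - d 1 - ... - d j\<close>.\<close>

fun staircase_rest :: "(nat \<Rightarrow> real ^ 'n) \<Rightarrow> nat \<Rightarrow> real ^ 'n \<Rightarrow> real ^ 'n" where
  "staircase_rest d 0 y = y"
| "staircase_rest d (Suc j) y = staircase_rest d j y - inf (staircase_rest d j y) (d (Suc j))"

text \<open>A vector \<open>y \<ge> 0\<close> is poured, coordinate by coordinate, into containers of capacities
  \<open>d 1, \<dots>, d (k - 1), \<infinity>\<close>; container \<open>i\<close> is used only once container \<open>i - 1\<close> is full. Numbering starts at 1, so
  \<open>staircase k d y 0\<close> is meaningless.\<close>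

definition staircase :: "nat \<Rightarrow> (nat \<Rightarrow> real ^ 'n) \<Rightarrow> real ^ 'n \<Rightarrow> nat \<Rightarrow> real ^ 'n" where
  "staircase k d y i =
     (if i < k then inf (staircase_rest d (i - 1) y) (d i) else staircase_rest d (i - 1) y)"

lemma staircase_rest_nonneg: "0 \<le> y \<Longrightarrow> 0 \<le> staircase_rest d j y"
  by (cases j) (auto simp: less_eq_vec_def inf_vec_def)

lemma continuous_on_staircase: "continuous_on S (\<lambda>y. staircase k d y i)"
proof -
  have inf: "inf u v = (\<chi> i. min (u $ i) (v $ i))" for u v :: "real ^ 'a"
    by (simp add: inf_vec_def inf_real_def)
  have "continuous_on S (\<lambda>y. staircase_rest d j y)" for j
    by (induction j) (auto simp: inf intro!: continuous_intros)
  then show ?thesis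
    by (cases "i < k") (auto simp: staircase_def inf intro!: continuous_intros)
qed

text \<open>The capped amounts are differences of successive remainders and telescope; container
  \<open>k\<close> takes the last remainder.\<close>

lemma sum_staircase:
  assumes "1 \<le> k"
  shows "(\<Sum>i = 1..k. staircase k d y i) = y"
proof -
  have "(\<Sum>i = 1..j. inf (staircase_rest d (i - 1) y) (d i)) = y - staircase_rest d j y" for j
    by (induction j) auto
  moreover obtain m where "k = Suc m" using assms by (cases k) auto
  ultimately show ?thesis
    by (simp add: staircase_def)
qed

lemma norm_staircase_le:
  assumes "0 \<le> y" "0 \<le> d i" "i < k"
  shows "norm (staircase k d y i) \<le> norm (d i)"
  using assms staircase_rest_nonneg[OF assms(1), of d "i - 1"]
  by (intro norm_le_componentwise_cart)
    (auto simp: staircase_def less_eq_vec_def inf_vec_def inf_real_def)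

text \<open>In each coordinate, either container \<open>j\<close> is full, or it took the whole
  remainder and nothing is left for \<open>j + 1\<close>.\<close>

lemma staircase_complementary:
  assumes "0 \<le> y" "\<forall>j\<in>{1..<k}. d j \<in> pos_orthant" "j \<in> {1..<k}"
  shows "inf (d j - staircase k d y j) (staircase k d y (j + 1)) = 0"
proof -
  obtain m where m: "j = Suc m" using assms(3) by (cases j) auto
  \<comment> \<open>If container \<open>j + 1\<close> is capped, its content is nonnegative only
    because its capacity is.\<close>
  have "\<not> d (Suc j) $ i < 0" if "Suc j < k" for i
    using assms(2) that by (auto simp: pos_orthant_def not_less less_imp_le)
  then show ?thesis
    using assms(3) m staircase_rest_nonneg[OF assms(1), of d m]
    by (auto simp: staircase_def vec_eq_iff inf_vec_def inf_real_def min_def less_eq_vec_def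
      not_le less_imp_le)
qed

text \<open>Since \<open>d 1\<close> is positive, capping \<open>y\<close> by it does not change
  which coordinates vanish.\<close>

lemma staircase_first_complementary:
  assumes "inf w y = 0" "0 \<le> y" "1 < k \<Longrightarrow> d 1 \<in> pos_orthant"
  shows "inf w (staircase k d y 1) = 0"
proof (cases "1 < k")
  case True
  have "inf w (inf y (d 1)) $ i = 0" for i
  proof -
    have "min (w $ i) (y $ i) = 0" using assms(1) by (auto simp: vec_eq_iff inf_vec_def inf_real_def)
    moreover have "0 < d 1 $ i" using assms(3) True by (auto simp: pos_orthant_def)
    ultimately show ?thesis by (auto simp: inf_vec_def inf_real_def min_def split: if_splits)
  qed
  then show ?thesis using True by (simp add: staircase_def vec_eq_iff)
qed (use assms in \<open>simp add: staircase_def\<close>)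

lemma matrix_inv_right: "invertible A \<Longrightarrow> A ** matrix_inv A = mat 1"
  unfolding invertible_def matrix_inv_def by (rule someI2_ex) auto

text \<open>A kernel vector \<open>x\<close> of \<open>C 0\<close> yields the admissible tuple
  \<open>(x, 0, ..., 0)\<close>, hence is 0.\<close>

lemma SSM_W_invertible:
  assumes "SSM_W k C"
  shows "invertible (C 0)"
proof -
  have "x = 0" if "C 0 *v x = 0" for x
    using assms[unfolded SSM_W_def, rule_format, of "\<lambda>i. if i = 0 then x else 0" 0] that
    by (auto simp: less_eq_vec_def)
  then show ?thesis
    using invertible_left_inverse matrix_left_invertible_ker by blast
qed

lemma SSM_W_strictly_semimonotone:
  assumes "1 \<le> k" "SSM_W k C" "0 \<le> u" "u * ((matrix_inv (C 0) ** C k) *v u) \<le> 0"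
  shows "u = 0"
proof -
  \<comment> \<open>Only \<open>x 0\<close> and \<open>x k\<close> may be nonzero;
    \<open>x 0\<close> is what the linear equation forces for \<open>x k = u\<close>.\<close>
  let ?x = "\<lambda>i. if i = 0 then (matrix_inv (C 0) ** C k) *v u else if i = k then u else 0"
  have "C 0 ** (matrix_inv (C 0) ** C k) = C k"
    using SSM_W_invertible[OF assms(2)] by (simp add: matrix_mul_assoc matrix_inv_right)
  then have "C 0 *v ?x 0 = C k *v u"
    by (simp add: matrix_vector_mul_assoc)
  also have "\<dots> = (\<Sum>i = 1..k. if i = k then C k *v u else 0)"
    using assms(1) by simp
  also have "\<dots> = (\<Sum>i = 1..k. C i *v ?x i)"
    by (intro sum.cong) auto
  finally have "C 0 *v ?x 0 = (\<Sum>i = 1..k. C i *v ?x i)" .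
  moreover have "\<forall>i\<in>{1..k}. 0 \<le> ?x i \<and> ?x 0 * ?x i \<le> 0"
    using assms(3,4) by (auto simp: mult.commute)
  ultimately have "\<forall>i\<in>{0..k}. ?x i = 0"
    using assms(2)[unfolded SSM_W_def, THEN spec[of _ ?x]] by simp
  then have "?x k = 0" by auto
  then show ?thesis using assms(1) by auto
qed

theorem theorem4p9:
  fixes k :: nat and C :: "nat \<Rightarrow> real ^ 'n ^ 'n"
  assumes "1 \<le> k" and "SSM_W k C"
  shows "\<forall>q :: real ^ 'n. \<forall>d :: nat \<Rightarrow> real ^ 'n.
           (\<forall>j \<in> {1..<k}. d j \<in> pos_orthant) \<longrightarrow> SOL k C d q \<noteq> {}"
proof (intro allI impI)
  fix q :: "real ^ 'n" and d :: "nat \<Rightarrow> real ^ 'n"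
  assume d: "\<forall>j \<in> {1..<k}. d j \<in> pos_orthant"
  let ?A = "matrix_inv (C 0)"
  \<comment> \<open>\<open>f y\<close> is the \<open>x 0\<close> forced by the linear equation once
    \<open>y\<close> has been poured.\<close>
  define f where "f y = ?A *v (q + (\<Sum>i = 1..k. C i *v staircase k d y i))" for y
  define B where
    "B = onorm ((*v) ?A) * (norm q + (\<Sum>i = 1..k. onorm ((*v) (C i - C k)) * norm (d i)))"
  have "continuous_on {y. 0 \<le> y} f"
    unfolding f_def
    by (intro continuous_intros continuous_on_staircase
        linear_continuous_on_compose[OF _ matrix_vector_mul_linear])
  moreover have "norm (f y - (?A ** C k) *v y) \<le> B" if "0 \<le> y" for y
  proof -
    let ?x = "staircase k d y"
    \<comment> \<open>Splitting \<open>y\<close> along the containers cancels the unbounded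
      \<open>k\<close>-th term, leaving coefficients \<open>C i - C k\<close>.\<close>
    have "C k *v y = (\<Sum>i = 1..k. C k *v ?x i)"
      using linear_sum[OF matrix_vector_mul_linear, of "C k" ?x "{1..k}"]
      unfolding sum_staircase[OF assms(1)] .
    then have "f y - (?A ** C k) *v y = ?A *v (q + (\<Sum>i = 1..k. (C i - C k) *v ?x i))"
      by (simp add: f_def matrix_vector_mul_assoc[symmetric] matrix_vector_mult_diff_rdistrib
          sum_subtractf add_diff_eq flip: matrix_vector_mult_diff_distrib)
    also have "norm \<dots> \<le> onorm ((*v) ?A) * norm (q + (\<Sum>i = 1..k. (C i - C k) *v ?x i))"
      by (rule onorm) (rule matrix_vector_mul_bounded_linear)
    also have "\<dots> \<le> B"
      unfolding B_def
    proof (intro mult_left_mono norm_triangle_le add_left_mono sum_norm_le)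
      fix i assume i: "i \<in> {1..k}"
      show "norm ((C i - C k) *v ?x i) \<le> onorm ((*v) (C i - C k)) * norm (d i)"
      proof (cases "i = k")
        case False
        have "norm ((C i - C k) *v ?x i) \<le> onorm ((*v) (C i - C k)) * norm (?x i)"
          by (rule onorm) (rule matrix_vector_mul_bounded_linear)
        also have "\<dots> \<le> onorm ((*v) (C i - C k)) * norm (d i)"
          using i False d that
          by (intro mult_left_mono norm_staircase_le onorm_pos_le matrix_vector_mul_bounded_linear)
            (auto simp: pos_orthant_def less_eq_vec_def less_imp_le)
        finally show ?thesis .
      qed (simp add: onorm_pos_le)
    qed (simp add: onorm_pos_le)
    finally show ?thesis .
  qed
  ultimately obtain y where y: "0 \<le> y" "inf (f y) y = 0"
    using nonlinear_complementarity[of "?A ** C k" f B]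
      SSM_W_strictly_semimonotone[OF assms] by blast
  \<comment> \<open>Index 0, meaningless for \<open>staircase\<close>, is overridden by
    \<open>f y\<close>; the restriction supplies extensionality.\<close>
  let ?x = "\<lambda>i\<in>{0..k}. if i = 0 then f y else staircase k d y i"
  have "C 0 *v f y = q + (\<Sum>i = 1..k. C i *v staircase k d y i)"
    using SSM_W_invertible[OF assms(2)]
    by (simp add: f_def matrix_vector_mul_assoc matrix_inv_right)
  moreover have "inf (f y) (staircase k d y 1) = 0"
    using y d by (intro staircase_first_complementary) auto
  moreover have "inf (d j - staircase k d y j) (staircase k d y (j + 1)) = 0" if "j \<in> {1..<k}" for j
    using staircase_complementary[OF y(1) d that] .
  ultimately have "?x \<in> SOL k C d q"
    using assms(1) by (auto simp: SOL_def)
  then show "SOL k C d q \<noteq> {}" by blast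
qed

end
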